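(* Let $f:\mathbb{R}^n\to\mathbb{R}$ be twice continuously differentiable with non-empty set $\mathcal{X}^*$ of global minimizers and minimum value $f^*$. Let $x^0\in\mathbb{R}^n$, and suppose that there are a closed convex set $\mathcal{F}\subset\mathbb{R}^n$ with $\mathcal{L}(f(x^0))\subset\operatorname{int}(\mathcal{F})$ and a constant $L>0$ such that $\|\nabla^2 f(x)-\nabla^2 f(y)\|\le L\|x-y\|$ for all $x,y\in\mathcal{F}$. Suppose that $f$ is gradient-dominated of degree $2$. Let $\{x^k\}_{k\ge0}$ be a sequence of iterates generated by the cubic regularization (CR) method from $x^0$. If $\mathcal{L}(f(x^k))$ is bounded for some $k\ge 0$, then the whole sequence $\{x^k\}_{k\ge0}$ converges at least Q-quadratically to a point $x^*\in\mathcal{X}^*$.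
   Context: $\|\cdot\|$ is the Euclidean norm for vectors and the operator norm for matrices. For $x\in\mathbb{R}^n$, $\mathcal{L}(f(x))=\{y\in\mathbb{R}^n: f(y)\le f(x)\}$. $f$ is gradient-dominated of degree $2$ if there exists $\tau_f>0$ such that $f(x)-f^*\le\tau_f\|\nabla f(x)\|^2$ for all $x\in\mathbb{R}^n$. Cubic model: for $\sigma>0$ and $x,p\in\mathbb{R}^n$, $$f_\sigma(p;x)=f(x)+\nabla f(x)^T(p-x)+\tfrac12(p-x)^T\nabla^2 f(x)(p-x)+\tfrac{\sigma}{6}\|p-x\|^3,$$ $\bar f_\sigma(x)=\min_{p\in\mathbb{R}^n}f_\sigma(p;x)$, and $p_\sigma(x)$ denotes a global minimizer of $f_\sigma(\cdot\,;x)$ over $\mathbb{R}^n$. CR method: given an initial point $x^0$ and a scalar $\bar\sigma\in(0,L]$ (with $L$ the Lipschitz constant of $\nabla^2 f$ on $\mathcal{F}$), for $k=0,1,2,\dots$ find $\sigma_k\in[\bar\sigma,2L]$ such that $f(p_{\sigma_k}(x^k))\le\bar f_{\sigma_k}(x^k)$, and set $x^{k+1}=p_{\sigma_k}(x^k)$. A sequence $\{w^k\}$ converges (at least) Q-quadratically to $w^\infty$ if $w^k\to w^\infty$ and there exists $M>0$ such that $\|w^{k+1}-w^\infty\|\le M\|w^k-w^\infty\|^2$ for all sufficiently large $k$. *)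

theory Defs
  imports "HOL-Analysis.Analysis"
begin

definition gradient :: "('a::real_inner \<Rightarrow> real) \<Rightarrow> 'a \<Rightarrow> 'a" where
  "gradient f x = (THE D. GDERIV f x :> D)"

definition hessian :: "(real ^ 'n \<Rightarrow> real) \<Rightarrow> real ^ 'n \<Rightarrow> real ^ 'n ^ 'n" where
  "hessian f x = jacobian (gradient f) (at x)"

lemma gradient_eqI: "GDERIV f x :> D \<Longrightarrow> gradient f x = D"
  unfolding gradient_def
proof (rule the_equality)
  fix E assume "GDERIV f x :> D" "GDERIV f x :> E"
  then have "(\<lambda>h. h \<bullet> D) = (\<lambda>h. h \<bullet> E)"
    unfolding gderiv_def by (rule has_derivative_unique)
  then have "\<forall>h. h \<bullet> E = h \<bullet> D"
    by (simp add: fun_eq_iff)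
  then show "E = D"
    by (simp only: vector_eq_ldot vector_eq_rdot)
qed

lemma GDERIV_gradient:
  fixes f :: "'a::euclidean_space \<Rightarrow> real"
  assumes "f differentiable (at x)"
  shows "GDERIV f x :> gradient f x"
proof -
  obtain f' where f': "(f has_derivative f') (at x)"
    using assms by (auto simp: differentiable_def)
  then have "linear f'"
    by (rule has_derivative_linear)
  then have "f' = (\<lambda>h. h \<bullet> adjoint f' 1)"
    by (simp add: adjoint_works)
  with f' have "GDERIV f x :> adjoint f' 1"
    unfolding gderiv_def by (rule back_subst)
  then show ?thesis
    by (simp only: gradient_eqI[OF \<open>GDERIV f x :> adjoint f' 1\<close>])
qed

lemma has_derivative_gradient_hessian:
  assumes "gradient f differentiable (at x)"
  shows "(gradient f has_derivative (\<lambda>h. hessian f x *v h)) (at x)"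
  using assms unfolding hessian_def by (simp add: jacobian_works)

definition twice_continuously_differentiable :: "(real ^ 'n \<Rightarrow> real) \<Rightarrow> bool" where
  "twice_continuously_differentiable f \<longleftrightarrow>
     f differentiable_on UNIV \<and> gradient f differentiable_on UNIV \<and> continuous_on UNIV (hessian f)"

definition global_minimizers :: "('a \<Rightarrow> real) \<Rightarrow> 'a set" where
  "global_minimizers f = {x. is_arg_min f (\<lambda>_. True) x}"

text \<open>The infimum is the minimum value whenever a global minimizer exists.\<close>

definition min_value :: "('a \<Rightarrow> real) \<Rightarrow> real" where
  "min_value f = (INF x. f x)"

lemma min_value_eq: "x \<in> global_minimizers f \<Longrightarrow> min_value f = f x"
  unfolding min_value_def global_minimizers_def is_arg_min_def
  by (rule cInf_eq_minimum) (auto simp: not_less)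

definition level_set :: "('a \<Rightarrow> real) \<Rightarrow> real \<Rightarrow> 'a set" where
  "level_set f c = {y. f y \<le> c}"

text \<open>The norm on matrices is the operator norm induced by the Euclidean norm; \<open>norm\<close> on
  \<^typ>\<open>real ^ 'n ^ 'n\<close> would be the Frobenius norm.\<close>

definition hessian_lipschitz_on :: "real \<Rightarrow> (real ^ 'n) set \<Rightarrow> (real ^ 'n \<Rightarrow> real) \<Rightarrow> bool" where
  "hessian_lipschitz_on L F f \<longleftrightarrow>
     (\<forall>x\<in>F. \<forall>y\<in>F. onorm ((*v) (hessian f x - hessian f y)) \<le> L * norm (x - y))"

definition gradient_dominated2 :: "(real ^ 'n \<Rightarrow> real) \<Rightarrow> bool" where
  "gradient_dominated2 f \<longleftrightarrow>
     (\<exists>\<tau>>0. \<forall>x. f x - min_value f \<le> \<tau> * (norm (gradient f x))\<^sup>2)"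

definition cubic_model :: "(real ^ 'n \<Rightarrow> real) \<Rightarrow> real \<Rightarrow> real ^ 'n \<Rightarrow> real ^ 'n \<Rightarrow> real" where
  "cubic_model f \<sigma> x p =
     f x + gradient f x \<bullet> (p - x) + 1 / 2 * ((p - x) \<bullet> (hessian f x *v (p - x)))
     + \<sigma> / 6 * norm (p - x) ^ 3"

text \<open>Global minimizers of the cubic model need not be unique, so the next iterate may be any one
  that passes the acceptance test.\<close>

definition CR_iterates ::
  "(real ^ 'n \<Rightarrow> real) \<Rightarrow> real \<Rightarrow> real \<Rightarrow> real ^ 'n \<Rightarrow> (nat \<Rightarrow> real) \<Rightarrow> (nat \<Rightarrow> real ^ 'n) \<Rightarrow> bool" where
  "CR_iterates f L \<sigma>bar x0 \<sigma> x \<longleftrightarrow>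
     0 < \<sigma>bar \<and> \<sigma>bar \<le> L \<and> x 0 = x0 \<and>
     (\<forall>k. \<sigma> k \<in> {\<sigma>bar..2 * L} \<and>
          x (Suc k) \<in> global_minimizers (cubic_model f (\<sigma> k) (x k)) \<and>
          f (x (Suc k)) \<le> min_value (cubic_model f (\<sigma> k) (x k)))"

definition converges_Q_quadratically :: "(nat \<Rightarrow> 'a::real_normed_vector) \<Rightarrow> 'a \<Rightarrow> bool" where
  "converges_Q_quadratically w l \<longleftrightarrow>
     w \<longlonglongrightarrow> l \<and>
     (\<exists>M>0. \<forall>\<^sub>F k in sequentially. norm (w (Suc k) - l) \<le> M * (norm (w k - l))\<^sup>2)"

end

theory Submission
  imports Defs
begin

text \<open>Write \<open>X\<close> for the set of global minimizers, \<open>d\<^sub>k\<close> for the distance of the \<open>k\<close>-th iterate to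
  \<open>X\<close>, and \<open>s\<^sub>k\<close> for its \<open>k\<close>-th step. Three inequalities drive the convergence.

  First, gradient domination is a global error bound, \<open>infdist z X \<le> 4 * \<tau> * norm (gradient f z)\<close>
  (\<open>gradient_dominated_error_bound\<close>): away from \<open>X\<close> it bounds the gradient of \<open>sqrt (f - f\<^sup>*)\<close> below
  by a positive constant, so descent reaches the value \<open>f\<^sup>*\<close> within a distance proportional to
  \<open>sqrt (f z - f\<^sup>*)\<close>. Ekeland's variational principle replaces the descent curve.

  Second, cancelling the model's first-order condition in the Taylor formula for the gradient shows
  that the gradient at the new point is of order \<open>(norm s\<^sub>k)\<^sup>2\<close> (\<open>cubic_step_gradient_bound\<close>).

  Third, the step is not much longer than the distance to any minimizer,
  \<open>norm s\<^sub>k \<le> c * d\<^sub>k\<close> (\<open>cubic_step_length_bound\<close>), because the Hessian is positive semidefinite at a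
  minimizer and the cubic term penalizes steps that overshoot.

  Together these give \<open>d\<^bsub>k+1\<^esub> \<le> C * d\<^sub>k\<^sup>2\<close>. Since each step also decreases \<open>f\<close> by a multiple of
  \<open>(norm s\<^sub>k)^3\<close> and \<open>f\<close> is bounded below, \<open>s\<^sub>k\<close> tends to \<open>0\<close>, and then \<open>d\<^sub>k\<close> does by the first two
  inequalities. From there \<open>d\<^sub>k\<close> at least halves in each step, so the remaining path length is at most
  \<open>2 * c * d\<^sub>k\<close>: the iterates form a Cauchy sequence and inherit the quadratic rate of \<open>d\<^sub>k\<close>
  (\<open>quadratic_convergence_from_distances\<close>).\<close>

section \<open>Quadratic convergence from the distance to a target set\<close>

text \<open>The distances are eventually halved in each step, so the tail of the path is dominated by a
  geometric series, and \<open>norm (w k - l)\<close> is comparable with \<open>infdist (w k) S\<close> from both sides.\<close>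

lemma quadratic_convergence_from_distances:
  fixes w :: "nat \<Rightarrow> 'a::banach"
  assumes "closed S" "S \<noteq> {}"
    and lim0: "(\<lambda>k. infdist (w k) S) \<longlonglongrightarrow> 0"
    and c: "c \<ge> 0" and step: "\<And>k. norm (w (Suc k) - w k) \<le> c * infdist (w k) S"
    and C: "C \<ge> 0" and contr: "\<And>k. infdist (w (Suc k)) S \<le> C * (infdist (w k) S)\<^sup>2"
  shows "\<exists>l\<in>S. converges_Q_quadratically w l"
proof -
  define d where "d k = infdist (w k) S" for k
  have d0: "d k \<ge> 0" for k
    unfolding d_def by (rule infdist_nonneg)
  have "(\<lambda>k. C * d k) \<longlonglongrightarrow> C * 0"
    unfolding d_def by (intro tendsto_intros lim0)
  then have "\<forall>\<^sub>F k in sequentially. C * d k < 1 / 2"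
    by (rule order_tendstoD) simp
  then obtain N where N: "\<And>k. k \<ge> N \<Longrightarrow> C * d k < 1 / 2"
    by (auto simp: eventually_sequentially)
  have half: "d (Suc k) \<le> d k / 2" if "k \<ge> N" for k
  proof -
    have "d (Suc k) \<le> (C * d k) * d k"
      using contr[of k] by (simp add: d_def power2_eq_square mult.assoc)
    also have "\<dots> \<le> 1 / 2 * d k"
      using N[OF that] d0 by (intro mult_right_mono) auto
    finally show ?thesis by simp
  qed
  have tail: "norm (w (k + m) - w k) \<le> 2 * c * d k" if "k \<ge> N" for k m
    using that
  proof (induction m arbitrary: k)
    case 0
    then show ?case using c d0 by simp
  next
    case (Suc m)
    have "norm (w (k + Suc m) - w k) \<le> norm (w (Suc k + m) - w (Suc k)) + norm (w (Suc k) - w k)"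
      using norm_triangle_ineq[of "w (Suc k + m) - w (Suc k)" "w (Suc k) - w k"] by simp
    also have "\<dots> \<le> 2 * c * d (Suc k) + c * d k"
      using Suc.IH[of "Suc k"] Suc.prems step[of k] by (simp add: d_def)
    also have "\<dots> \<le> 2 * c * (d k / 2) + c * d k"
      using half[OF Suc.prems] c by (intro add_right_mono mult_left_mono) auto
    finally show ?case by simp
  qed
  have "Cauchy w"
  proof (rule metric_CauchyI)
    fix e :: real assume "e > 0"
    have "(\<lambda>k. 2 * c * d k) \<longlonglongrightarrow> 2 * c * 0"
      unfolding d_def by (intro tendsto_intros lim0)
    then have "\<forall>\<^sub>F k in sequentially. 2 * c * d k < e / 2"
      by (rule order_tendstoD) (use \<open>e > 0\<close> in simp)
    then have "\<forall>\<^sub>F k in sequentially. 2 * c * d k < e / 2 \<and> k \<ge> N"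
      using eventually_ge_at_top by (rule eventually_conj)
    then obtain K where K: "2 * c * d K < e / 2" "K \<ge> N"
      by (auto simp: eventually_sequentially)
    have near: "dist (w m) (w K) < e / 2" if "m \<ge> K" for m
      using tail[OF K(2), of "m - K"] K(1) that by (simp add: dist_norm)
    show "\<exists>M. \<forall>m\<ge>M. \<forall>n\<ge>M. dist (w m) (w n) < e"
      using near by (metis dist_triangle_half_l)
  qed
  then obtain l where l: "w \<longlonglongrightarrow> l"
    by (auto simp: Cauchy_convergent_iff convergent_def)
  have "(\<lambda>k. infdist (w k) S) \<longlonglongrightarrow> infdist l S"
    by (intro tendsto_intros l)
  then have "infdist l S = 0"
    using lim0 by (rule LIMSEQ_unique)
  then have "l \<in> S"
    using assms(1,2) by (simp add: in_closed_iff_infdist_zero)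
  have rate: "norm (w k - l) \<le> 2 * c * d k" if "k \<ge> N" for k
  proof (rule Lim_bounded)
    show "(\<lambda>m. norm (w k - w m)) \<longlonglongrightarrow> norm (w k - l)"
      by (intro tendsto_intros l)
    show "\<forall>m\<ge>k. norm (w k - w m) \<le> 2 * c * d k"
      using tail[OF that] by (metis le_add_diff_inverse norm_minus_commute)
  qed
  have "norm (w (Suc k) - l) \<le> (2 * c * C + 1) * (norm (w k - l))\<^sup>2" if "k \<ge> N" for k
  proof -
    have "d k \<le> norm (w k - l)"
      using infdist_le[OF \<open>l \<in> S\<close>, of "w k"] by (simp add: d_def dist_norm)
    then have sq: "(d k)\<^sup>2 \<le> (norm (w k - l))\<^sup>2"
      using d0 by (intro power_mono) auto
    have "norm (w (Suc k) - l) \<le> 2 * c * d (Suc k)"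
      using rate[of "Suc k"] that by simp
    also have "\<dots> \<le> 2 * c * (C * (d k)\<^sup>2)"
      using contr[of k] c by (intro mult_left_mono) (auto simp: d_def)
    also have "\<dots> \<le> 2 * c * (C * (norm (w k - l))\<^sup>2)"
      using sq c C by (intro mult_left_mono) auto
    also have "\<dots> \<le> (2 * c * C + 1) * (norm (w k - l))\<^sup>2"
      by (simp add: algebra_simps)
    finally show ?thesis .
  qed
  then have "\<forall>\<^sub>F k in sequentially. norm (w (Suc k) - l) \<le> (2 * c * C + 1) * (norm (w k - l))\<^sup>2"
    by (auto simp: eventually_sequentially)
  moreover have "2 * c * C + 1 > 0"
    using c C by (simp add: add_nonneg_pos)
  ultimately have "converges_Q_quadratically w l"
    unfolding converges_Q_quadratically_def using l by blast
  with \<open>l \<in> S\<close> show ?thesis by blast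
qed

section \<open>First and second derivatives along lines\<close>

lemma twice_continuously_differentiableD:
  assumes "twice_continuously_differentiable f"
  shows "GDERIV f z :> gradient f z"
    and "(gradient f has_derivative (\<lambda>h. hessian f z *v h)) (at z)"
    and "continuous_on UNIV (hessian f)"
    and "continuous_on UNIV f"
  using assms unfolding twice_continuously_differentiable_def
  by (auto simp: differentiable_on_def intro!: GDERIV_gradient has_derivative_gradient_hessian
      differentiable_imp_continuous_on)

lemma GDERIV_along_line:
  assumes "GDERIV f (a + t *\<^sub>R u) :> D"
  shows "((\<lambda>t. f (a + t *\<^sub>R u)) has_real_derivative (u \<bullet> D)) (at t)"
proof -
  have line: "((\<lambda>t. a + t *\<^sub>R u) has_derivative (\<lambda>h. h *\<^sub>R u)) (at t)"
    by (auto intro!: derivative_eq_intros)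
  have "((\<lambda>t. f (a + t *\<^sub>R u)) has_derivative (\<lambda>h. (h *\<^sub>R u) \<bullet> D)) (at t)"
    using has_derivative_compose[OF line] assms unfolding gderiv_def by blast
  then show ?thesis
    by (simp add: has_field_derivative_def mult_commute_abs)
qed

lemma gradient_along_line:
  assumes "twice_continuously_differentiable f"
  shows "((\<lambda>t. v \<bullet> gradient f (a + t *\<^sub>R u)) has_real_derivative
          (v \<bullet> (hessian f (a + t *\<^sub>R u) *v u))) (at t)"
proof -
  have line: "((\<lambda>t. a + t *\<^sub>R u) has_derivative (\<lambda>h. h *\<^sub>R u)) (at t)"
    by (auto intro!: derivative_eq_intros)
  have "((\<lambda>t. gradient f (a + t *\<^sub>R u)) has_derivative
      (\<lambda>h. hessian f (a + t *\<^sub>R u) *v (h *\<^sub>R u))) (at t)"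
    using has_derivative_compose[OF line twice_continuously_differentiableD(2)[OF assms]] .
  then have "((\<lambda>t. v \<bullet> gradient f (a + t *\<^sub>R u)) has_derivative
      (\<lambda>h. v \<bullet> (hessian f (a + t *\<^sub>R u) *v (h *\<^sub>R u)))) (at t)"
    by (rule has_derivative_inner_right)
  then show ?thesis
    by (simp add: has_field_derivative_def mult_commute_abs matrix_vector_mult_scaleR)
qed

section \<open>Symmetry and positivity of the Hessian\<close>

text \<open>The left-hand side does not change when \<open>u\<close> and \<open>v\<close> are exchanged; this is where the symmetry
  of the Hessian comes from.\<close>

lemma second_difference_mean_value:
  fixes f :: "real ^ 'n \<Rightarrow> real"
  assumes f: "twice_continuously_differentiable f" and t: "t > 0"
  obtains \<xi> \<eta> where "0 < \<xi>" "\<xi> < t" "0 < \<eta>" "\<eta> < t"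
    "f (a + t *\<^sub>R u + t *\<^sub>R v) - f (a + t *\<^sub>R u) - f (a + t *\<^sub>R v) + f a
      = t\<^sup>2 * (u \<bullet> (hessian f (a + \<xi> *\<^sub>R u + \<eta> *\<^sub>R v) *v v))"
proof -
  let ?D = "\<lambda>r. u \<bullet> gradient f ((a + t *\<^sub>R v) + r *\<^sub>R u) - u \<bullet> gradient f (a + r *\<^sub>R u)"
  have "((\<lambda>r. f ((a + t *\<^sub>R v) + r *\<^sub>R u) - f (a + r *\<^sub>R u)) has_real_derivative ?D r) (at r)" for r
    by (intro DERIV_diff GDERIV_along_line twice_continuously_differentiableD(1)[OF f])
  from MVT2[OF t this] obtain \<xi> where \<xi>: "0 < \<xi>" "\<xi> < t" and eq1:
    "(f ((a + t *\<^sub>R v) + t *\<^sub>R u) - f (a + t *\<^sub>R u)) - (f ((a + t *\<^sub>R v) + 0 *\<^sub>R u) - f (a + 0 *\<^sub>R u))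
      = (t - 0) * ?D \<xi>"
    by blast
  have "((\<lambda>r. u \<bullet> gradient f ((a + \<xi> *\<^sub>R u) + r *\<^sub>R v)) has_real_derivative
      (u \<bullet> (hessian f ((a + \<xi> *\<^sub>R u) + r *\<^sub>R v) *v v))) (at r)" for r
    by (rule gradient_along_line[OF f])
  from MVT2[OF t this] obtain \<eta> where \<eta>: "0 < \<eta>" "\<eta> < t" and eq2:
    "u \<bullet> gradient f ((a + \<xi> *\<^sub>R u) + t *\<^sub>R v) - u \<bullet> gradient f ((a + \<xi> *\<^sub>R u) + 0 *\<^sub>R v)
      = (t - 0) * (u \<bullet> (hessian f ((a + \<xi> *\<^sub>R u) + \<eta> *\<^sub>R v) *v v))"
    by blast
  have comm: "a + t *\<^sub>R v + r *\<^sub>R u = a + r *\<^sub>R u + t *\<^sub>R v" for r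
    by simp
  show thesis
    by (rule that[OF \<xi> \<eta>]) (use eq1 eq2 in \<open>simp add: comm power2_eq_square algebra_simps\<close>)
qed

lemma hessian_symmetric:
  fixes f :: "real ^ 'n \<Rightarrow> real"
  assumes f: "twice_continuously_differentiable f"
  shows "u \<bullet> (hessian f a *v v) = v \<bullet> (hessian f a *v u)"
proof (rule ccontr)
  let ?A = "\<lambda>z. u \<bullet> (hessian f z *v v)" and ?B = "\<lambda>z. v \<bullet> (hessian f z *v u)"
  assume ne: "?A a \<noteq> ?B a"
  define e where "e = \<bar>?A a - ?B a\<bar> / 2"
  have e: "e > 0" using ne by (simp add: e_def)
  have cont: "isCont (\<lambda>z. p \<bullet> (hessian f z *v q)) a" for p q
  proof -
    have "isCont (hessian f) a"
      using twice_continuously_differentiableD(3)[OF f] by (simp add: continuous_on_eq_continuous_at)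
    moreover have "linear (\<lambda>A. p \<bullet> (A *v q))"
      by (rule linearI) (simp_all add: matrix_vector_mult_add_rdistrib inner_add_right
          flip: scaleR_matrix_vector_assoc)
    then have "isCont (\<lambda>A. p \<bullet> (A *v q)) (hessian f a)"
      by (intro linear_continuous_at) (simp add: linear_conv_bounded_linear)
    ultimately show ?thesis
      by (rule isCont_o2)
  qed
  obtain r1 where r1: "r1 > 0" "\<And>z. dist z a < r1 \<Longrightarrow> \<bar>?A z - ?A a\<bar> < e"
    using cont[of u v] e unfolding continuous_at_eps_delta dist_real_def by meson
  obtain r2 where r2: "r2 > 0" "\<And>z. dist z a < r2 \<Longrightarrow> \<bar>?B z - ?B a\<bar> < e"
    using cont[of v u] e unfolding continuous_at_eps_delta dist_real_def by meson
  define r where "r = min r1 r2"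
  define t where "t = r / (norm u + norm v + 1)"
  have t: "t > 0" using r1 r2 by (simp add: t_def r_def add_nonneg_pos)
  have small: "dist (a + \<xi> *\<^sub>R p + \<eta> *\<^sub>R q) a < r"
    if "0 < \<xi>" "\<xi> < t" "0 < \<eta>" "\<eta> < t" "norm p + norm q = norm u + norm v" for \<xi> \<eta> p q
  proof -
    have "dist (a + \<xi> *\<^sub>R p + \<eta> *\<^sub>R q) a \<le> norm (\<xi> *\<^sub>R p) + norm (\<eta> *\<^sub>R q)"
      using norm_triangle_ineq[of "\<xi> *\<^sub>R p" "\<eta> *\<^sub>R q"] by (simp add: dist_norm)
    also have "\<dots> \<le> t * norm p + t * norm q"
      using that by (intro add_mono) (auto intro!: mult_right_mono)
    also have "\<dots> = t * (norm u + norm v)"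
      using that by (simp flip: distrib_left)
    also have "\<dots> < t * (norm u + norm v + 1)"
      using t by simp
    also have "\<dots> = r"
      by (simp add: t_def add_nonneg_pos less_imp_neq[symmetric])
    finally show ?thesis .
  qed
  obtain \<xi> \<eta> where A: "0 < \<xi>" "\<xi> < t" "0 < \<eta>" "\<eta> < t"
    "f (a + t *\<^sub>R u + t *\<^sub>R v) - f (a + t *\<^sub>R u) - f (a + t *\<^sub>R v) + f a
      = t\<^sup>2 * ?A (a + \<xi> *\<^sub>R u + \<eta> *\<^sub>R v)"
    using second_difference_mean_value[OF f t, where u = u and v = v] by metis
  obtain \<xi>' \<eta>' where B: "0 < \<xi>'" "\<xi>' < t" "0 < \<eta>'" "\<eta>' < t"
    "f (a + t *\<^sub>R v + t *\<^sub>R u) - f (a + t *\<^sub>R v) - f (a + t *\<^sub>R u) + f a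
      = t\<^sup>2 * ?B (a + \<xi>' *\<^sub>R v + \<eta>' *\<^sub>R u)"
    using second_difference_mean_value[OF f t, where u = v and v = u] by metis
  have swap: "a + t *\<^sub>R v + t *\<^sub>R u = a + t *\<^sub>R u + t *\<^sub>R v"
    by simp
  have "t\<^sup>2 * ?A (a + \<xi> *\<^sub>R u + \<eta> *\<^sub>R v) = t\<^sup>2 * ?B (a + \<xi>' *\<^sub>R v + \<eta>' *\<^sub>R u)"
    using A(5) B(5)[unfolded swap] by linarith
  then have eq: "?A (a + \<xi> *\<^sub>R u + \<eta> *\<^sub>R v) = ?B (a + \<xi>' *\<^sub>R v + \<eta>' *\<^sub>R u)"
    using t by simp
  have "\<bar>?A (a + \<xi> *\<^sub>R u + \<eta> *\<^sub>R v) - ?A a\<bar> < e"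
    using small[OF A(1-4)] by (intro r1) (simp add: r_def)
  moreover have "\<bar>?B (a + \<xi>' *\<^sub>R v + \<eta>' *\<^sub>R u) - ?B a\<bar> < e"
    using small[OF B(1-4)] by (intro r2) (simp add: r_def)
  ultimately show False
    using eq unfolding e_def by argo
qed

lemma global_minimizers_iff: "z \<in> global_minimizers f \<longleftrightarrow> (\<forall>y. f z \<le> f y)"
  for f :: "'a \<Rightarrow> real"
  by (auto simp: global_minimizers_def is_arg_min_def not_less)

lemma gradient_at_minimizer:
  fixes f :: "'a::euclidean_space \<Rightarrow> real"
  assumes "GDERIV f z :> D" "z \<in> global_minimizers f"
  shows "D = 0"
proof -
  have "(\<lambda>h. h \<bullet> D) = (\<lambda>h. 0)"
    using assms unfolding gderiv_def global_minimizers_iff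
    by (intro has_derivative_local_min[of f]) auto
  then show ?thesis
    by (metis inner_eq_zero_iff)
qed

text \<open>A direction of negative curvature at a critical point is a direction of descent.\<close>

lemma hessian_psd_at_minimizer:
  fixes f :: "real ^ 'n \<Rightarrow> real"
  assumes f: "twice_continuously_differentiable f" and z: "z \<in> global_minimizers f"
  shows "v \<bullet> (hessian f z *v v) \<ge> 0"
proof (rule ccontr)
  assume neg: "\<not> ?thesis"
  let ?q = "\<lambda>t. v \<bullet> gradient f (z + t *\<^sub>R v)"
  have "(?q has_real_derivative (v \<bullet> (hessian f (z + 0 *\<^sub>R v) *v v))) (at 0)"
    by (rule gradient_along_line[OF f])
  then have "\<exists>d>0. \<forall>h>0. h < d \<longrightarrow> ?q 0 > ?q (0 + h)"
    by (rule DERIV_neg_dec_right) (use neg in simp)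
  moreover have "gradient f z = 0"
    using gradient_at_minimizer[OF twice_continuously_differentiableD(1)[OF f] z] .
  ultimately obtain d where d: "d > 0" "\<And>h. 0 < h \<Longrightarrow> h < d \<Longrightarrow> ?q h < 0"
    by auto
  have "((\<lambda>t. f (z + t *\<^sub>R v)) has_real_derivative ?q t) (at t)" for t
    by (intro GDERIV_along_line twice_continuously_differentiableD(1)[OF f])
  from MVT2[of 0 "d / 2", OF _ this] d(1) obtain \<xi> where
    \<xi>: "0 < \<xi>" "\<xi> < d / 2" "f (z + (d / 2) *\<^sub>R v) - f (z + 0 *\<^sub>R v) = (d / 2 - 0) * ?q \<xi>"
    by auto
  have "?q \<xi> < 0"
    using \<xi> d by simp
  then have "(d / 2 - 0) * ?q \<xi> < 0"
    using d(1) by (intro mult_pos_neg) auto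
  then have "f (z + (d / 2) *\<^sub>R v) < f z"
    using \<xi>(3) by simp
  with z show False
    unfolding global_minimizers_iff by (meson not_less)
qed

section \<open>Gradient domination as an error bound\<close>

text \<open>A form of Ekeland's principle that needs only compactness of balls: \<open>y\<close> minimizes
  \<open>\<lambda>z. \<phi> z + c * dist x z\<close>.\<close>

lemma ekeland_heine_borel:
  fixes \<phi> :: "'a::heine_borel \<Rightarrow> real"
  assumes cont: "continuous_on UNIV \<phi>" and nonneg: "\<And>z. \<phi> z \<ge> 0" and c: "c > 0"
  obtains y where "c * dist x y \<le> \<phi> x" "\<And>z. \<phi> y - c * dist y z \<le> \<phi> z"
proof -
  let ?F = "\<lambda>z. \<phi> z + c * dist x z" and ?K = "cball x (\<phi> x / c)"
  have "x \<in> ?K"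
    using nonneg[of x] c by simp
  then have "?K \<noteq> {}"
    by blast
  moreover have "continuous_on ?K ?F"
    by (intro continuous_intros continuous_on_subset[OF cont]) auto
  ultimately obtain y where y: "y \<in> ?K" "\<And>z. z \<in> ?K \<Longrightarrow> ?F y \<le> ?F z"
    using continuous_attains_inf[of ?K ?F] by auto
  have "?F y \<le> ?F x"
    using \<open>x \<in> ?K\<close> by (rule y)
  then have yx: "?F y \<le> \<phi> x" by simp
  have glob: "?F y \<le> ?F z" for z
  proof (cases "z \<in> ?K")
    case False
    then have "\<phi> x < c * dist x z"
      using c by (simp add: field_simps)
    then show ?thesis
      using yx nonneg[of z] by linarith
  qed (use y in auto)
  show thesis
  proof (rule that)
    show "c * dist x y \<le> \<phi> x"
      using yx nonneg[of y] by linarith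
    show "\<phi> y - c * dist y z \<le> \<phi> z" for z
    proof -
      have "c * dist x z \<le> c * (dist x y + dist y z)"
        using c by (intro mult_left_mono dist_triangle) auto
      then show ?thesis
        using glob[of z] by (simp add: algebra_simps)
    qed
  qed
qed

text \<open>Where \<open>f\<close> exceeds its minimum \<open>m\<close>, gradient domination says that \<open>\<lambda>z. sqrt (f z - m)\<close> has slope at
  least \<open>1 / (2 * sqrt \<tau>)\<close>. Ekeland's point for half this slope therefore has to be a minimizer.\<close>

lemma gradient_dominated_error_bound:
  fixes f :: "'a::euclidean_space \<Rightarrow> real"
  assumes diff: "\<And>z. GDERIV f z :> gradient f z"
    and ne: "global_minimizers f \<noteq> {}" and \<tau>: "\<tau> > 0"
    and dom: "\<And>z. f z - min_value f \<le> \<tau> * (norm (gradient f z))\<^sup>2"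
  shows "infdist x (global_minimizers f) \<le> 4 * \<tau> * norm (gradient f x)"
proof -
  define m where "m = min_value f"
  define \<phi> where "\<phi> z = sqrt (f z - m)" for z
  define c where "c = 1 / (4 * sqrt \<tau>)"
  obtain z0 where z0: "z0 \<in> global_minimizers f" using ne by blast
  have m: "m \<le> f z" for z
    using z0 unfolding m_def min_value_eq[OF z0] by (simp add: global_minimizers_iff)
  have c: "c > 0" using \<tau> by (simp add: c_def)
  have \<phi>_le: "\<phi> z \<le> sqrt \<tau> * norm (gradient f z)" for z
    using real_sqrt_le_mono[OF dom[of z]] by (simp add: \<phi>_def m_def real_sqrt_mult)
  have "continuous_on UNIV f"
    using diff unfolding gderiv_def
    by (meson has_derivative_continuous continuous_at_imp_continuous_on)
  then have "continuous_on UNIV \<phi>"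
    unfolding \<phi>_def by (intro continuous_intros)
  moreover have "\<phi> z \<ge> 0" for z
    using m[of z] by (simp add: \<phi>_def)
  ultimately obtain y where y: "c * dist x y \<le> \<phi> x" "\<And>z. \<phi> y - c * dist y z \<le> \<phi> z"
    using ekeland_heine_borel[OF _ _ c, of \<phi> x] by metis
  have "f y = m"
  proof (rule ccontr)
    assume "f y \<noteq> m"
    then have pos: "f y - m > 0" using m[of y] by simp
    then have \<phi>y: "\<phi> y > 0" by (simp add: \<phi>_def)
    define g where "g = gradient f y"
    have g: "norm g > 0"
      using \<phi>y \<phi>_le[of y] \<tau> by (auto simp: g_def zero_less_mult_iff dest: less_le_trans)
    have slope: "c < norm g / (2 * \<phi> y)"
    proof -
      have "4 * (c * \<phi> y) \<le> norm g"
        using \<phi>_le[of y] \<tau> by (simp add: c_def g_def field_simps)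
      then have "2 * (c * \<phi> y) < norm g"
        using c \<phi>y mult_pos_pos[of c "\<phi> y"] by linarith
      then show ?thesis
        using \<phi>y by (simp add: field_simps)
    qed
    let ?q = "\<lambda>t. \<phi> (y + t *\<^sub>R (- g)) + c * (t * norm g)"
    have "((\<lambda>t. f (y + t *\<^sub>R (- g)) - m) has_real_derivative (- g) \<bullet> g - 0) (at 0)"
      using diff[of y]
      by (intro DERIV_diff GDERIV_along_line DERIV_const) (simp add: g_def)
    then have "((\<lambda>t. \<phi> (y + t *\<^sub>R (- g))) has_real_derivative
        inverse (sqrt (f (y + 0 *\<^sub>R (- g)) - m)) / 2 * ((- g) \<bullet> g - 0)) (at 0)"
      unfolding \<phi>_def by (intro DERIV_chain2[OF DERIV_real_sqrt]) (use pos in simp)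
    then have "(?q has_real_derivative
        inverse (sqrt (f (y + 0 *\<^sub>R (- g)) - m)) / 2 * ((- g) \<bullet> g - 0) + c * (1 * norm g)) (at 0)"
      by (intro DERIV_add DERIV_cmult DERIV_cmult_right DERIV_ident)
    moreover have "inverse (sqrt (f (y + 0 *\<^sub>R (- g)) - m)) / 2 * ((- g) \<bullet> g - 0) + c * (1 * norm g)
        = norm g * (c - norm g / (2 * \<phi> y))"
      using \<phi>y by (simp add: \<phi>_def dot_square_norm power2_eq_square field_simps)
    moreover have "\<dots> < 0"
      using g slope by (intro mult_pos_neg) auto
    ultimately have "(?q has_real_derivative norm g * (c - norm g / (2 * \<phi> y))) (at 0)"
      "norm g * (c - norm g / (2 * \<phi> y)) < 0"
      by (simp_all only:)
    from DERIV_neg_dec_right[OF this] obtain d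
      where d: "d > 0" "\<forall>h>0. h < d \<longrightarrow> ?q 0 > ?q (0 + h)"
      by blast
    from d(2)[rule_format, of "d / 2"] d(1) have "?q 0 > ?q (0 + d / 2)"
      by linarith
    moreover have "\<phi> y - c * dist y (y + (d / 2) *\<^sub>R (- g)) \<le> \<phi> (y + (d / 2) *\<^sub>R (- g))"
      by (rule y(2))
    ultimately show False
      using d(1) by (simp add: dist_norm)
  qed
  then have "y \<in> global_minimizers f"
    using m by (simp add: global_minimizers_iff)
  then have "infdist x (global_minimizers f) \<le> dist x y"
    by (rule infdist_le)
  also have "\<dots> \<le> 4 * sqrt \<tau> * \<phi> x"
    using y(1) \<tau> by (simp add: c_def field_simps)
  also have "\<dots> \<le> 4 * sqrt \<tau> * (sqrt \<tau> * norm (gradient f x))"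
    using \<phi>_le[of x] \<tau> by (intro mult_left_mono) auto
  also have "\<dots> = 4 * \<tau> * norm (gradient f x)"
    using \<tau> by simp
  finally show ?thesis .
qed

section \<open>Minimizers of the cubic model\<close>

lemma has_derivative_norm_cubed:
  fixes s :: "'a::real_inner"
  shows "((\<lambda>p. norm p ^ 3) has_derivative (\<lambda>h. 3 * norm s * (s \<bullet> h))) (at s)"
proof (cases "s = 0")
  case True
  have "((\<lambda>h::'a. norm h ^ 2) \<longlongrightarrow> norm (0::'a) ^ 2) (at 0)"
    by (intro tendsto_intros)
  moreover have "\<forall>\<^sub>F h in at (0::'a). norm h ^ 2 = norm (norm h ^ 3) / norm h"
    by (auto simp: eventually_at_filter power3_eq_cube power2_eq_square)
  ultimately have "((\<lambda>h::'a. norm (norm h ^ 3) / norm h) \<longlongrightarrow> 0) (at 0)"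
    using tendsto_cong by force
  then show ?thesis
    using True by (simp add: has_derivative_at)
next
  case False
  have "((\<lambda>p. norm p ^ 3) has_derivative (\<lambda>h. of_nat 3 * (h \<bullet> sgn s) * norm s ^ (3 - 1))) (at s)"
    using has_derivative_power[OF has_derivative_norm[OF False], of 3] by simp
  moreover have "of_nat 3 * (h \<bullet> sgn s) * norm s ^ (3 - 1) = 3 * norm s * (s \<bullet> h)" for h
    using False by (simp add: sgn_div_norm inner_commute[of h] power2_eq_square field_simps)
  ultimately show ?thesis
    by (simp only:)
qed

lemma cubic_model_stationary:
  fixes f :: "real ^ 'n \<Rightarrow> real"
  assumes f: "twice_continuously_differentiable f"
    and p: "p \<in> global_minimizers (cubic_model f \<sigma> x)"
  shows "gradient f x + hessian f x *v (p - x) + (\<sigma> / 2 * norm (p - x)) *\<^sub>R (p - x) = 0"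
    (is "?D = 0")
proof (rule gradient_at_minimizer[OF _ p])
  have shift: "((\<lambda>p. p - x) has_derivative (\<lambda>h. h)) (at p)"
    by (auto intro!: derivative_eq_intros)
  have cube: "((\<lambda>p. norm (p - x) ^ 3) has_derivative
      (\<lambda>h. 3 * norm (p - x) * ((p - x) \<bullet> h))) (at p)"
    using has_derivative_compose[OF shift has_derivative_norm_cubed] .
  have mult: "((\<lambda>p. hessian f x *v (p - x)) has_derivative (\<lambda>h. hessian f x *v h)) (at p)"
    using bounded_linear.has_derivative[OF matrix_vector_mul_bounded_linear shift] .
  have "(cubic_model f \<sigma> x has_derivative (\<lambda>h. 0 + gradient f x \<bullet> h
      + 1 / 2 * ((p - x) \<bullet> (hessian f x *v h) + h \<bullet> (hessian f x *v (p - x)))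
      + \<sigma> / 6 * (3 * norm (p - x) * ((p - x) \<bullet> h)))) (at p)"
    unfolding cubic_model_def[abs_def]
    by (intro has_derivative_add has_derivative_const has_derivative_inner_right
        has_derivative_mult_right has_derivative_inner shift mult cube)
  moreover have "0 + gradient f x \<bullet> h
      + 1 / 2 * ((p - x) \<bullet> (hessian f x *v h) + h \<bullet> (hessian f x *v (p - x)))
      + \<sigma> / 6 * (3 * norm (p - x) * ((p - x) \<bullet> h)) = h \<bullet> ?D" for h
    using hessian_symmetric[OF f, of "p - x" x h]
    by (simp add: inner_add_right inner_commute[of h "gradient f x"] inner_commute[of h "p - x"])
  ultimately show "GDERIV (cubic_model f \<sigma> x) p :> ?D"
    unfolding gderiv_def by simp
qed

text \<open>Comparing the minimizer \<open>x + s\<close> with its mirror image \<open>x - s\<close> changes only the linear term of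
  the model, so \<open>gradient f x \<bullet> s \<le> 0\<close>. The first-order condition along \<open>s\<close> then expresses the quadratic term
  by the other two.\<close>

lemma cubic_model_decrease:
  fixes f :: "real ^ 'n \<Rightarrow> real"
  assumes f: "twice_continuously_differentiable f"
    and p: "p \<in> global_minimizers (cubic_model f \<sigma> x)"
  shows "min_value (cubic_model f \<sigma> x) \<le> f x - \<sigma> / 12 * norm (p - x) ^ 3"
proof -
  define s where "s = p - x"
  have reflect: "x - s - x = - s" by simp
  have neg_mult: "hessian f x *v (- s) = - (hessian f x *v s)"
    using matrix_vector_mult_diff_distrib[of "hessian f x" 0 s] by simp
  have "cubic_model f \<sigma> x p \<le> cubic_model f \<sigma> x (x - s)"
    using p by (simp add: global_minimizers_iff)
  then have lin: "gradient f x \<bullet> s \<le> 0"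
    unfolding cubic_model_def reflect neg_mult by (simp flip: s_def)
  have "s \<bullet> (gradient f x + hessian f x *v s + (\<sigma> / 2 * norm s) *\<^sub>R s) = 0"
    using cubic_model_stationary[OF f p] by (simp add: s_def)
  then have quad: "s \<bullet> (hessian f x *v s) = - (gradient f x \<bullet> s) - \<sigma> / 2 * norm s ^ 3"
    by (simp add: inner_add_right inner_commute[of s "gradient f x"] dot_square_norm
        power2_eq_square power3_eq_cube)
  have "min_value (cubic_model f \<sigma> x) = cubic_model f \<sigma> x p"
    by (rule min_value_eq[OF p])
  also have "\<dots> = f x + gradient f x \<bullet> s + 1 / 2 * (s \<bullet> (hessian f x *v s)) + \<sigma> / 6 * norm s ^ 3"
    by (simp add: cubic_model_def s_def)
  also have "\<dots> \<le> f x - \<sigma> / 12 * norm s ^ 3"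
    using lin unfolding quad by (simp add: field_simps)
  finally show ?thesis by (simp add: s_def)
qed

section \<open>Step estimates under a Lipschitz Hessian\<close>

lemma hessian_lipschitz_onD:
  assumes "hessian_lipschitz_on L F f" "x \<in> F" "y \<in> F"
  shows "norm ((hessian f x - hessian f y) *v v) \<le> L * norm (x - y) * norm v"
proof -
  have "norm ((hessian f x - hessian f y) *v v)
      \<le> onorm ((*v) (hessian f x - hessian f y)) * norm v"
    by (rule onorm) (rule matrix_vector_mul_bounded_linear)
  also have "\<dots> \<le> L * norm (x - y) * norm v"
    using assms unfolding hessian_lipschitz_on_def by (intro mult_right_mono) auto
  finally show ?thesis .
qed

text \<open>The mean value inequality on the segment for \<open>\<lambda>z. gradient f z - hessian f x *v z\<close>, whose derivative is
  the difference of two Hessians.\<close>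

lemma gradient_taylor_bound:
  fixes f :: "real ^ 'n \<Rightarrow> real"
  assumes f: "twice_continuously_differentiable f"
    and lip: "hessian_lipschitz_on L F f" and F: "convex F" "x \<in> F" "y \<in> F" and L: "L \<ge> 0"
  shows "norm (gradient f y - gradient f x - hessian f x *v (y - x)) \<le> L * (norm (y - x))\<^sup>2"
proof -
  let ?S = "closed_segment x y"
  have sub: "?S \<subseteq> F"
    using F by (simp add: closed_segment_subset)
  have "norm ((gradient f y - hessian f x *v y) - (gradient f x - hessian f x *v x))
      \<le> L * norm (y - x) * norm (y - x)"
  proof (rule differentiable_bound[where f' = "\<lambda>z. (*v) (hessian f z - hessian f x)" and S = ?S])
    fix z assume z: "z \<in> ?S"
    have "((\<lambda>z. gradient f z - hessian f x *v z) has_derivative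
        (\<lambda>h. hessian f z *v h - hessian f x *v h)) (at z)"
      by (intro has_derivative_diff twice_continuously_differentiableD(2)[OF f]
          bounded_linear_imp_has_derivative matrix_vector_mul_bounded_linear)
    then have "((\<lambda>z. gradient f z - hessian f x *v z) has_derivative
        (*v) (hessian f z - hessian f x)) (at z)"
      by (simp flip: matrix_vector_mult_diff_rdistrib)
    then show "((\<lambda>z. gradient f z - hessian f x *v z) has_derivative
        (*v) (hessian f z - hessian f x)) (at z within ?S)"
      by (rule has_derivative_at_withinI)
    have "onorm ((*v) (hessian f z - hessian f x)) \<le> L * norm (z - x)"
      using lip z sub F(2) unfolding hessian_lipschitz_on_def by blast
    also have "\<dots> \<le> L * norm (y - x)"
      using segment_bound1[OF z] L by (intro mult_left_mono) auto
    finally show "onorm ((*v) (hessian f z - hessian f x)) \<le> L * norm (y - x)" .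
  qed auto
  then show ?thesis
    by (simp add: power2_eq_square algebra_simps)
qed

lemma cubic_step_gradient_bound:
  fixes f :: "real ^ 'n \<Rightarrow> real"
  assumes f: "twice_continuously_differentiable f"
    and lip: "hessian_lipschitz_on L F f" and F: "convex F" "x \<in> F" "p \<in> F" and L: "L \<ge> 0"
    and p: "p \<in> global_minimizers (cubic_model f \<sigma> x)" and \<sigma>: "0 \<le> \<sigma>" "\<sigma> \<le> 2 * L"
  shows "norm (gradient f p) \<le> 2 * L * (norm (p - x))\<^sup>2"
proof -
  define r where "r = gradient f p - gradient f x - hessian f x *v (p - x)"
  have "gradient f p = r - (\<sigma> / 2 * norm (p - x)) *\<^sub>R (p - x)"
    using cubic_model_stationary[OF f p] by (simp add: r_def algebra_simps eq_neg_iff_add_eq_0)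
  then have "norm (gradient f p) \<le> norm r + norm ((\<sigma> / 2 * norm (p - x)) *\<^sub>R (p - x))"
    by (metis norm_triangle_ineq4)
  also have "\<dots> = norm r + \<sigma> / 2 * (norm (p - x))\<^sup>2"
    using \<sigma> by (simp add: power2_eq_square)
  also have "\<dots> \<le> L * (norm (p - x))\<^sup>2 + L * (norm (p - x))\<^sup>2"
    using gradient_taylor_bound[OF f lip F L] \<sigma> unfolding r_def
    by (intro add_mono mult_right_mono) auto
  finally show ?thesis by simp
qed

text \<open>Write \<open>s = p - x\<close> and \<open>d = z - x\<close>. Subtract the first-order condition of the model from the Taylor
  formula for \<open>gradient f z = 0\<close> and test with \<open>s - d\<close>. As the Hessian is positive semidefinite at \<open>z\<close>,
  it is at least \<open>- L * norm d\<close> at \<open>x\<close>, and what remains is an inequality between forms of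
  degree three in \<open>norm s\<close> and \<open>norm d\<close> in which \<open>(norm s)^3\<close> stands on the small side.\<close>

lemma cubic_step_length_bound:
  fixes f :: "real ^ 'n \<Rightarrow> real"
  assumes f: "twice_continuously_differentiable f"
    and lip: "hessian_lipschitz_on L F f" and F: "convex F" "x \<in> F" "z \<in> F" and L: "L \<ge> 0"
    and p: "p \<in> global_minimizers (cubic_model f \<sigma> x)" and \<sigma>: "\<sigma> > 0"
    and z: "z \<in> global_minimizers f"
  shows "norm (p - x) \<le> (1 + 12 * L / \<sigma>) * norm (z - x)"
proof -
  define s where "s = p - x"
  define d where "d = z - x"
  define H where "H = hessian f x"
  define r where "r = gradient f x + H *v d"
  have "gradient f z = 0"
    using gradient_at_minimizer[OF twice_continuously_differentiableD(1)[OF f] z] .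
  then have r: "norm r \<le> L * (norm d)\<^sup>2"
    using gradient_taylor_bound[OF f lip F L] norm_minus_cancel[of r]
    by (simp add: r_def d_def H_def algebra_simps)
  have "gradient f x + H *v s + (\<sigma> / 2 * norm s) *\<^sub>R s = 0"
    using cubic_model_stationary[OF f p] by (simp add: s_def H_def)
  then have "(\<sigma> / 2 * norm s) *\<^sub>R s = - r - H *v (s - d)"
    by (simp add: r_def algebra_simps eq_neg_iff_add_eq_0)
  then have "(s - d) \<bullet> ((\<sigma> / 2 * norm s) *\<^sub>R s) = (s - d) \<bullet> (- r - H *v (s - d))"
    by simp
  then have tested: "\<sigma> / 2 * norm s * ((s - d) \<bullet> s) = - ((s - d) \<bullet> r) - (s - d) \<bullet> (H *v (s - d))"
    by (simp add: inner_diff_right)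
  have rest: "- ((s - d) \<bullet> r) \<le> norm (s - d) * (L * (norm d)\<^sup>2)"
  proof -
    have "- ((s - d) \<bullet> r) \<le> norm (s - d) * norm r"
      using Cauchy_Schwarz_ineq2[of "s - d" r] by linarith
    also have "\<dots> \<le> norm (s - d) * (L * (norm d)\<^sup>2)"
      using r by (intro mult_left_mono) auto
    finally show ?thesis .
  qed
  have curv: "- ((s - d) \<bullet> (H *v (s - d))) \<le> L * norm d * (norm (s - d))\<^sup>2"
  proof -
    let ?v = "s - d" and ?E = "hessian f z - H"
    have "- (?v \<bullet> (H *v ?v)) \<le> ?v \<bullet> (?E *v ?v)"
      using hessian_psd_at_minimizer[OF f z, of ?v]
      by (simp add: matrix_vector_mult_diff_rdistrib inner_diff_right)
    also have "\<dots> \<le> norm ?v * norm (?E *v ?v)"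
      by (rule norm_cauchy_schwarz)
    also have "\<dots> \<le> norm ?v * (L * norm (z - x) * norm ?v)"
      unfolding H_def by (intro mult_left_mono hessian_lipschitz_onD[OF lip] F) auto
    finally show ?thesis
      by (simp add: d_def power2_eq_square mult_ac)
  qed
  define t where "t = norm s"
  define \<delta> where "\<delta> = norm d"
  have nn: "t \<ge> 0" "\<delta> \<ge> 0" by (auto simp: t_def \<delta>_def)
  have tri: "norm (s - d) \<le> t + \<delta>"
    by (simp add: t_def \<delta>_def norm_triangle_ineq4)
  have "t \<le> (1 + 12 * L / \<sigma>) * \<delta>"
  proof (cases "t \<le> \<delta>")
    case True
    moreover have "0 \<le> 12 * L / \<sigma> * \<delta>"
      using L \<sigma> nn by simp
    ultimately show ?thesis
      by (simp add: distrib_right)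
  next
    case False
    then have lt: "\<delta> < t" "t > 0" using nn by auto
    have "t * (t - \<delta>) \<le> (s - d) \<bullet> s"
      using norm_cauchy_schwarz[of d s]
      by (simp add: t_def \<delta>_def dot_square_norm power2_eq_square algebra_simps)
    then have "\<sigma> / 2 * t * (t * (t - \<delta>)) \<le> \<sigma> / 2 * t * ((s - d) \<bullet> s)"
      using \<sigma> nn by (intro mult_left_mono) auto
    also have "\<dots> \<le> norm (s - d) * (L * \<delta>\<^sup>2) + L * \<delta> * (norm (s - d))\<^sup>2"
      using tested rest curv by (simp add: t_def \<delta>_def)
    also have "\<dots> \<le> (2 * t) * (L * (\<delta> * t)) + L * \<delta> * (2 * t)\<^sup>2"
      using tri lt nn L
      by (intro add_mono mult_mono power_mono) (auto simp: power2_eq_square intro!: mult_mono)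
    also have "\<dots> = 6 * L * \<delta> * t\<^sup>2"
      by (simp add: power2_eq_square)
    finally have "(\<sigma> / 2 * (t - \<delta>)) * t\<^sup>2 \<le> (6 * L * \<delta>) * t\<^sup>2"
      by (simp add: power2_eq_square mult_ac)
    then have "\<sigma> / 2 * (t - \<delta>) \<le> 6 * L * \<delta>"
      using lt by (simp add: mult_le_cancel_right)
    then show ?thesis
      using \<sigma> by (simp add: field_simps)
  qed
  then show ?thesis
    by (simp add: t_def \<delta>_def s_def d_def)
qed

section \<open>Convergence of the cubic regularization method\<close>

lemma CR_iteratesD:
  assumes "CR_iterates f L \<sigma>bar x0 \<sigma> x"
  shows "0 < \<sigma>bar" "x 0 = x0" "\<sigma>bar \<le> \<sigma> k" "\<sigma> k \<le> 2 * L"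
    "x (Suc k) \<in> global_minimizers (cubic_model f (\<sigma> k) (x k))"
    "f (x (Suc k)) \<le> min_value (cubic_model f (\<sigma> k) (x k))"
  using assms unfolding CR_iterates_def by auto

lemma CR_iterates_decrease:
  fixes f :: "real ^ 'n \<Rightarrow> real"
  assumes f: "twice_continuously_differentiable f" and cr: "CR_iterates f L \<sigma>bar x0 \<sigma> x"
  shows "\<sigma>bar / 12 * norm (x (Suc k) - x k) ^ 3 \<le> f (x k) - f (x (Suc k))"
proof -
  have "\<sigma>bar / 12 * norm (x (Suc k) - x k) ^ 3 \<le> \<sigma> k / 12 * norm (x (Suc k) - x k) ^ 3"
    using CR_iteratesD(3)[OF cr] by (intro mult_right_mono) auto
  also have "\<dots> \<le> f (x k) - f (x (Suc k))"
    using cubic_model_decrease[OF f CR_iteratesD(5)[OF cr, of k]] CR_iteratesD(6)[OF cr, of k]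
    by linarith
  finally show ?thesis .
qed

lemma CR_iterates_decseq:
  fixes f :: "real ^ 'n \<Rightarrow> real"
  assumes f: "twice_continuously_differentiable f" and cr: "CR_iterates f L \<sigma>bar x0 \<sigma> x"
  shows "decseq (\<lambda>k. f (x k))"
proof (rule decseq_SucI)
  fix k
  have "0 \<le> \<sigma>bar / 12 * norm (x (Suc k) - x k) ^ 3"
    using CR_iteratesD(1)[OF cr] by simp
  then show "f (x (Suc k)) \<le> f (x k)"
    using CR_iterates_decrease[OF f cr, of k] by linarith
qed

lemma CR_steps_tendsto_zero:
  fixes f :: "real ^ 'n \<Rightarrow> real"
  assumes f: "twice_continuously_differentiable f" and ne: "global_minimizers f \<noteq> {}"
    and cr: "CR_iterates f L \<sigma>bar x0 \<sigma> x"
  shows "(\<lambda>k. norm (x (Suc k) - x k)) \<longlonglongrightarrow> 0"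
proof -
  obtain z where z: "\<And>y. f z \<le> f y"
    using ne by (meson ex_in_conv global_minimizers_iff)
  obtain l where l: "(\<lambda>k. f (x k)) \<longlonglongrightarrow> l"
    using decseq_convergent[OF CR_iterates_decseq[OF f cr], of "f z"] z by blast
  have "(\<lambda>k. 12 / \<sigma>bar * (f (x k) - f (x (Suc k)))) \<longlonglongrightarrow> 12 / \<sigma>bar * (l - l)"
    by (intro tendsto_intros l LIMSEQ_Suc)
  then have lim: "(\<lambda>k. 12 / \<sigma>bar * (f (x k) - f (x (Suc k)))) \<longlonglongrightarrow> 0"
    by simp
  have "(\<lambda>k. norm (x (Suc k) - x k) ^ 3) \<longlonglongrightarrow> 0"
  proof (rule tendsto_sandwich[OF _ _ tendsto_const lim])
    have "norm (x (Suc k) - x k) ^ 3 \<le> 12 / \<sigma>bar * (f (x k) - f (x (Suc k)))" for k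
      using CR_iterates_decrease[OF f cr, of k] CR_iteratesD(1)[OF cr] by (simp add: field_simps)
    then show "\<forall>\<^sub>F k in sequentially.
        norm (x (Suc k) - x k) ^ 3 \<le> 12 / \<sigma>bar * (f (x k) - f (x (Suc k)))"
      by simp
  qed simp
  then have "(\<lambda>k. root 3 (norm (x (Suc k) - x k) ^ 3)) \<longlonglongrightarrow> root 3 0"
    by (rule tendsto_real_root)
  then show ?thesis
    by (simp add: real_root_power_cancel)
qed

theorem corollary3:
  fixes f :: "real ^ 'n \<Rightarrow> real"
    and x0 :: "real ^ 'n"
    and F :: "(real ^ 'n) set"
    and L \<sigma>bar :: real
    and \<sigma> :: "nat \<Rightarrow> real"
    and x :: "nat \<Rightarrow> real ^ 'n"
  assumes "twice_continuously_differentiable f"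
    and "global_minimizers f \<noteq> {}"
    and "closed F" and "convex F"
    and "level_set f (f x0) \<subseteq> interior F"
    and "L > 0" and "hessian_lipschitz_on L F f"
    and "gradient_dominated2 f"
    and "CR_iterates f L \<sigma>bar x0 \<sigma> x"
    and "\<exists>k. bounded (level_set f (f (x k)))"
  shows "\<exists>xstar \<in> global_minimizers f. converges_Q_quadratically x xstar"
proof -
  note f = assms(1) and lip = assms(7) and cr = assms(9)
  let ?X = "global_minimizers f"
  define d where "d k = infdist (x k) ?X" for k
  define s where "s k = norm (x (Suc k) - x k)" for k
  define c where "c = 1 + 12 * L / \<sigma>bar"
  have \<sigma>bar: "\<sigma>bar > 0" using CR_iteratesD(1)[OF cr] .
  have \<sigma>_pos: "\<sigma> k > 0" for k using CR_iteratesD(3)[OF cr, of k] \<sigma>bar by linarith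
  have c: "c \<ge> 0" using assms(6) \<sigma>bar by (simp add: c_def)
  have levelF: "z \<in> F" if "f z \<le> f x0" for z
    using that assms(5) interior_subset by (auto simp: level_set_def)
  have xF: "x k \<in> F" for k
    using decseqD[OF CR_iterates_decseq[OF f cr], of 0 k] CR_iteratesD(2)[OF cr]
    by (intro levelF) simp
  have XF: "z \<in> F" if "z \<in> ?X" for z
    using that by (intro levelF) (simp add: global_minimizers_iff)
  have "?X = (\<Inter>y. {z. f z \<le> f y})"
    by (auto simp: global_minimizers_iff)
  then have closedX: "closed ?X"
    using twice_continuously_differentiableD(4)[OF f]
    by (simp add: closed_INT closed_Collect_le)
  obtain \<tau> where \<tau>: "\<tau> > 0" "\<And>z. f z - min_value f \<le> \<tau> * (norm (gradient f z))\<^sup>2"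
    using assms(8) unfolding gradient_dominated2_def by blast
  have s0: "s k \<ge> 0" for k by (simp add: s_def)
  have step: "s k \<le> c * d k" for k
  proof -
    obtain z where z: "z \<in> ?X" "infdist (x k) ?X = dist (x k) z"
      using infdist_attains_inf[OF closedX assms(2)] by blast
    have "s k \<le> (1 + 12 * L / \<sigma> k) * norm (z - x k)"
      unfolding s_def using assms(6) \<sigma>_pos
      by (intro cubic_step_length_bound[OF f lip assms(4) xF XF[OF z(1)] _
            CR_iteratesD(5)[OF cr] _ z(1)]) auto
    also have "\<dots> \<le> c * norm (z - x k)"
      unfolding c_def using assms(6) \<sigma>bar CR_iteratesD(3)[OF cr, of k]
      by (intro mult_right_mono add_left_mono divide_left_mono mult_pos_pos \<sigma>_pos) auto
    finally show ?thesis
      using z(2) by (simp add: d_def dist_norm norm_minus_commute)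
  qed
  have dist_step: "d (Suc k) \<le> 8 * \<tau> * L * (s k)\<^sup>2" for k
  proof -
    have "d (Suc k) \<le> 4 * \<tau> * norm (gradient f (x (Suc k)))"
      unfolding d_def
      by (rule gradient_dominated_error_bound[OF twice_continuously_differentiableD(1)[OF f]
            assms(2) \<tau>])
    also have "\<dots> \<le> 4 * \<tau> * (2 * L * (s k)\<^sup>2)"
      unfolding s_def using \<tau>(1) assms(6) \<sigma>_pos[of k] CR_iteratesD(4)[OF cr, of k]
      by (intro mult_left_mono cubic_step_gradient_bound[OF f lip assms(4) xF xF _
            CR_iteratesD(5)[OF cr]]) auto
    finally show ?thesis by simp
  qed
  have contr: "d (Suc k) \<le> 8 * \<tau> * L * c\<^sup>2 * (d k)\<^sup>2" for k
  proof -
    have "(s k)\<^sup>2 \<le> (c * d k)\<^sup>2"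
      using step s0 by (intro power_mono) auto
    then have "8 * \<tau> * L * (s k)\<^sup>2 \<le> 8 * \<tau> * L * (c * d k)\<^sup>2"
      using \<tau>(1) assms(6) by (intro mult_left_mono) auto
    then show ?thesis
      using dist_step[of k] by (simp add: power_mult_distrib)
  qed
  have "(\<lambda>k. d (Suc k)) \<longlonglongrightarrow> 0"
  proof (rule tendsto_sandwich[OF _ _ tendsto_const])
    have "(\<lambda>k. 8 * \<tau> * L * (s k)\<^sup>2) \<longlonglongrightarrow> 8 * \<tau> * L * 0\<^sup>2"
      using CR_steps_tendsto_zero[OF f assms(2) cr] unfolding s_def by (intro tendsto_intros)
    then show "(\<lambda>k. 8 * \<tau> * L * (s k)\<^sup>2) \<longlonglongrightarrow> 0" by simp
  qed (use dist_step in \<open>auto simp: d_def infdist_nonneg\<close>)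
  then have "d \<longlonglongrightarrow> 0"
    by (simp add: filterlim_sequentially_Suc)
  then show ?thesis
    using step contr c \<tau>(1) assms(6) unfolding d_def s_def
    by (intro quadratic_convergence_from_distances[OF closedX assms(2), where c = c
          and C = "8 * \<tau> * L * c\<^sup>2"]) auto
qed

end
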